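(* Let $m\ge 3$ and $1\le r\le n$ be integers, and let $\mathcal S=\sum_{i=1}^r\lambda_i\,\mathbf u_i^{\circ m}$ be an orthogonally diagonalizable real symmetric tensor of order $m$ and dimension $n$, where $\mathbf u_1,\dots,\mathbf u_r\in\mathbb R^n$ are orthonormal and $\lambda_1,\dots,\lambda_r>0$. Consider the optimization problem $$\max_{\mathbf u\in\mathbb R^n}\ \mathcal S\mathbf u^m\quad\text{s.t.}\quad \mathbf u^{\mathrm T}\mathbf u=1 .$$ For a subset $\mathbb A\subseteq\{1,\dots,r\}$ with $|\mathbb A|=k$, $1\le k\le r$, by the linear combination of the basic eigenpairs $(\lambda_i,\mathbf u_i)$, $i\in\mathbb A$, we mean the Z-eigenpair $(\lambda,\mathbf u)$ of $\mathcal S$ given by $$\mathbf u=\frac1l\sum_{i\in\mathbb A}\tilde c_i\,\mathbf u_i,\qquad \lambda=\frac{1}{l^{m-2}},\qquad \tilde c_i=\sqrt[m-2]{1/\lambda_i},\qquad l=\Big(\sum_{i\in\mathbb A}\tilde c_i^{\,2}\Big)^{1/2},$$ where $\sqrt[m-2]{1/\lambda_i}$ denotes a real $(m-2)$-th root of $1/\lambda_i$. Then: Case 1: when $k=1$, $(\lambda_i,\mathbf u_i)$ (for each $i=1,2,\dots,r$) is an isolated local maximum solution of the problem. Case 2: when $1<k\le r<n$, a linear combination of the $(\lambda_i,\mathbf u_i)$, $i\in\mathbb A$, is a saddle point of the problem. Case 3: when $k=n$ (so $r=n$ and $\mathbb A=\{1,\dots,n\}$), a linear combination of the $(\lambda_i,\mathbf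 u_i)$, $i=1,2,\dots,n$, is the only one isolated local minimum solution of the problem.
   Context: For $\mathbf a\in\mathbb R^n$, $\mathbf a^{\circ m}$ is the order-$m$ symmetric tensor with entries $a_{i_1}\cdots a_{i_m}$. For a real symmetric tensor $\mathcal S=(s_{i_1,\dots,i_m})_{1\le i_1,\dots,i_m\le n}$, $\mathcal S\mathbf u^m=\sum_{i_1,\dots,i_m=1}^n s_{i_1,\dots,i_m}u_{i_1}\cdots u_{i_m}$, and $\mathcal S\mathbf u^{m-1}$ is the vector with $j$th entry $\sum_{i_2,\dots,i_m=1}^n s_{j,i_2,\dots,i_m}u_{i_2}\cdots u_{i_m}$. A Z-eigenpair of $\mathcal S$ is a pair $(\lambda,\mathbf u)$ with $\mathbf u\in\mathbb R^n$, $\mathbf u^{\mathrm T}\mathbf u=1$ and $\mathcal S\mathbf u^{m-1}=\lambda\mathbf u$; the Z-eigenvectors are the stationary points of the constrained problem. An eigenpair $(\lambda,\mathbf u)$ is called a local maximum solution, local minimum solution or saddle point of the problem when its eigenvector $\mathbf u$ is, respectively, a local maximizer, a local minimizer, or a stationary point that is neither, of $\mathbf u\mapsto\mathcal S\mathbf u^m$ on the unit sphere. A local maximum (minimum) solution is isolated if some neighbourhood of it on the sphere contains no other local maximizer (minimizer).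
   Formalization: Case 3's "only one" is false as stated; here it reads: every isolated local minimum solution is a linear combination of all n basic eigenpairs for some choice of real roots (several if m is even) or, when m is odd, one of the pairs (-λ_i, -u_i). *)

theory Defs
  imports "HOL-Analysis.Analysis" "HOL-Library.Multiset"
begin

text \<open>
  A real tensor of order \<open>m\<close> and dimension \<open>CARD('n)\<close> is a function on index lists; only its
  values on lists of length \<open>m\<close> are relevant.
\<close>

type_synonym 'n tensor = "'n list \<Rightarrow> real"

definition symmetric_tensor :: "nat \<Rightarrow> 'n tensor \<Rightarrow> bool" where
  "symmetric_tensor m S \<longleftrightarrow>
     (\<forall>is js. length is = m \<and> mset js = mset is \<longrightarrow> S js = S is)"

text \<open>
  The entry of index \<open>is\<close> of the rank-one power of \<open>a\<close>; the order of the power is \<open>length is\<close>.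
\<close>

definition tensor_power :: "real ^ 'n \<Rightarrow> 'n tensor" where
  "tensor_power a is = (\<Prod>i\<leftarrow>is. a $ i)"

definition tensor_form :: "nat \<Rightarrow> ('n::finite) tensor \<Rightarrow> real ^ 'n \<Rightarrow> real" where
  "tensor_form m S u = (\<Sum>is | length is = m. S is * (\<Prod>i\<leftarrow>is. u $ i))"

definition tensor_apply :: "nat \<Rightarrow> ('n::finite) tensor \<Rightarrow> real ^ 'n \<Rightarrow> real ^ 'n" where
  "tensor_apply m S u =
     (\<chi> j. \<Sum>is | length is = m - 1. S (j # is) * (\<Prod>i\<leftarrow>is. u $ i))"

definition Z_eigenpair :: "nat \<Rightarrow> ('n::finite) tensor \<Rightarrow> real \<Rightarrow> real ^ 'n \<Rightarrow> bool" where
  "Z_eigenpair m S \<mu> v \<longleftrightarrow> v \<bullet> v = 1 \<and> tensor_apply m S v = \<mu> *\<^sub>R v"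

definition local_maximizer_on :: "'a::topological_space set \<Rightarrow> ('a \<Rightarrow> real) \<Rightarrow> 'a \<Rightarrow> bool" where
  "local_maximizer_on X f x \<longleftrightarrow> x \<in> X \<and> (\<forall>\<^sub>F y in at x within X. f y \<le> f x)"

definition local_minimizer_on :: "'a::topological_space set \<Rightarrow> ('a \<Rightarrow> real) \<Rightarrow> 'a \<Rightarrow> bool" where
  "local_minimizer_on X f x \<longleftrightarrow> x \<in> X \<and> (\<forall>\<^sub>F y in at x within X. f x \<le> f y)"

definition isolated_local_max_solution ::
    "nat \<Rightarrow> ('n::finite) tensor \<Rightarrow> real \<Rightarrow> real ^ 'n \<Rightarrow> bool" where
  "isolated_local_max_solution m S \<mu> v \<longleftrightarrow>
     Z_eigenpair m S \<mu> v \<and>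
     local_maximizer_on (sphere 0 1) (tensor_form m S) v \<and>
     (\<forall>\<^sub>F w in at v within sphere 0 1.
        \<not> local_maximizer_on (sphere 0 1) (tensor_form m S) w)"

definition isolated_local_min_solution ::
    "nat \<Rightarrow> ('n::finite) tensor \<Rightarrow> real \<Rightarrow> real ^ 'n \<Rightarrow> bool" where
  "isolated_local_min_solution m S \<mu> v \<longleftrightarrow>
     Z_eigenpair m S \<mu> v \<and>
     local_minimizer_on (sphere 0 1) (tensor_form m S) v \<and>
     (\<forall>\<^sub>F w in at v within sphere 0 1.
        \<not> local_minimizer_on (sphere 0 1) (tensor_form m S) w)"

text \<open>
  The stationary points of the constrained problem are the Z-eigenvectors, so stationarity is
  expressed by \<^const>\<open>Z_eigenpair\<close>.
\<close>

definition saddle_point_solution ::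
    "nat \<Rightarrow> ('n::finite) tensor \<Rightarrow> real \<Rightarrow> real ^ 'n \<Rightarrow> bool" where
  "saddle_point_solution m S \<mu> v \<longleftrightarrow>
     Z_eigenpair m S \<mu> v \<and>
     \<not> local_maximizer_on (sphere 0 1) (tensor_form m S) v \<and>
     \<not> local_minimizer_on (sphere 0 1) (tensor_form m S) v"

text \<open>
  The coefficients \<open>c i\<close> range over all real \<open>(m - 2)\<close>-th roots of \<open>1 / lam i\<close>. For even \<open>m\<close> both
  signs are possible independently for each \<open>i\<close>, so this is a relation rather than a function.
\<close>

definition eigenpair_combination ::
    "nat \<Rightarrow> (nat \<Rightarrow> real) \<Rightarrow> (nat \<Rightarrow> real ^ 'n) \<Rightarrow> nat set \<Rightarrow> real \<Rightarrow> real ^ 'n \<Rightarrow> bool" where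
  "eigenpair_combination m lam u A \<mu> v \<longleftrightarrow>
     (\<exists>c l. (\<forall>i\<in>A. c i ^ (m - 2) = 1 / lam i) \<and>
            l = sqrt (\<Sum>i\<in>A. (c i)\<^sup>2) \<and>
            v = (1 / l) *\<^sub>R (\<Sum>i\<in>A. c i *\<^sub>R u i) \<and>
            \<mu> = 1 / l ^ (m - 2))"

end

theory Submission imports Defs begin

text \<open>
  In the coordinates \<open>x\<^sub>i = u i \<bullet> w\<close> the form is \<open>\<Sum>i. lam i * x\<^sub>i ^ m\<close>, and a unit vector is
  stationary with value \<open>\<mu>\<close> iff \<open>x\<^sub>i = 0\<close> or \<open>lam i * x\<^sub>i ^ (m - 2) = \<mu>\<close> for each \<open>i\<close>, and, when
  \<open>\<mu> \<noteq> 0\<close>, it lies in the span of the \<open>u i\<close>. Let \<open>v\<close> be stationary with value \<open>\<mu> > 0\<close> and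
  coordinates \<open>x\<^sub>i\<close>, nonzero exactly for \<open>i \<in> B\<close>. If a unit vector of the span of \<open>u i\<close>, \<open>i \<in> B\<close>, has
  coordinates \<open>x\<^sub>i * s\<^sub>i\<close> with \<open>s\<^sub>i > 0\<close>, then the form equals \<open>\<mu> * (\<Sum>i\<in>B. x\<^sub>i\<^sup>2 * s\<^sub>i ^ m)\<close> there,
  where \<open>\<Sum>i\<in>B. x\<^sub>i\<^sup>2 = \<Sum>i\<in>B. x\<^sub>i\<^sup>2 * s\<^sub>i\<^sup>2 = 1\<close>; by the power mean inequality this exceeds \<open>\<mu>\<close> unless
  all \<open>s\<^sub>i\<close> are 1. So \<open>v\<close> is a strict minimum within that span, hence not a maximum if
  \<open>|B| \<ge> 2\<close>. Along an arc from \<open>v\<close> towards a unit vector with coordinates supported off \<open>B\<close> the form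
  decreases, so \<open>v\<close> is a minimum only if \<open>B\<close> exhausts an orthonormal basis. For \<open>\<mu> < 0\<close> the
  situation is mirrored, which leaves only the minima \<open>- u i\<close> for odd \<open>m\<close>.

  Near \<open>u i\<close> every \<open>lam j * |x\<^sub>j| ^ (m - 2)\<close> with \<open>j \<noteq> i\<close> is below \<open>lam i * x\<^sub>i ^ (m - 2)\<close>. Hence
  Bessel's inequality bounds the form by \<open>lam i\<close>, and a stationary point there has \<open>x\<^sub>j = 0\<close>; as local
  extrema are stationary, \<open>u i\<close> is isolated.
\<close>

section \<open>Sums over index lists\<close>

lemma lists_length_Suc:
  "{is :: 'a list. length is = Suc k} = (\<lambda>(i, is). i # is) ` (UNIV \<times> {is. length is = k})"
  by (auto simp: length_Suc_conv image_iff)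

lemma sum_prod_list_length:
  fixes a :: "'a::finite \<Rightarrow> 'b::comm_semiring_1"
  shows "(\<Sum>is | length is = k. \<Prod>i\<leftarrow>is. a i) = (\<Sum>i\<in>UNIV. a i) ^ k"
proof (induction k)
  case (Suc k)
  have "(\<Sum>is | length is = Suc k. \<Prod>i\<leftarrow>is. a i)
      = (\<Sum>(i, is) \<in> UNIV \<times> {is. length is = k}. a i * (\<Prod>i\<leftarrow>is. a i))"
    unfolding lists_length_Suc by (subst sum.reindex) (auto simp: inj_on_def case_prod_unfold)
  also have "\<dots> = (\<Sum>i\<in>UNIV. a i) ^ Suc k"
    by (simp add: sum.cartesian_product[symmetric] sum_distrib_left[symmetric]
        sum_distrib_right[symmetric] Suc)
  finally show ?case .
qed simp

text \<open>Each term is a product of factors \<open>a $ i * w $ i\<close>, so summing over all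
  lists expands a power of the inner product. The case \<open>k = m\<close> evaluates
  \<open>tensor_form\<close>, the case \<open>k = m - 1\<close> evaluates
  \<open>tensor_apply\<close>.\<close>

lemma sum_tensor_power_mult:
  fixes a w :: "real ^ 'n::finite"
  shows "(\<Sum>is | length is = k. tensor_power a is * (\<Prod>i\<leftarrow>is. w $ i)) = (a \<bullet> w) ^ k"
proof -
  have "tensor_power a is * (\<Prod>i\<leftarrow>is. w $ i) = (\<Prod>i\<leftarrow>is. a $ i * w $ i)" for "is"
    by (induction "is") (simp_all add: tensor_power_def)
  then show ?thesis
    by (simp add: sum_prod_list_length inner_vec_def)
qed

section \<open>Power inequalities\<close>

text \<open>The tangent line at \<open>s\<^sup>2 = 1\<close> of \<open>s ^ (k + 2)\<close> as a convex function of \<open>s\<^sup>2\<close>.\<close>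

lemma power_tangent_at_1:
  fixes s :: real
  assumes "0 < s"
  shows "2 + real (k + 2) * (s\<^sup>2 - 1) \<le> 2 * s ^ (k + 2)"
    and "s \<noteq> 1 \<Longrightarrow> 0 < k \<Longrightarrow> 2 + real (k + 2) * (s\<^sup>2 - 1) < 2 * s ^ (k + 2)"
proof -
  \<comment> \<open>Multiplied by \<open>s\<close>, the bound for \<open>k\<close> exceeds the
    tangent for \<open>Suc k\<close> by exactly the term with \<open>(s - 1)\<^sup>2\<close>. This
    slack also yields the strict version.\<close>
  have step: "2 + real (Suc k + 2) * (s\<^sup>2 - 1) + (s - 1)\<^sup>2 * (real (k + 2) * (s + 1) - 1)
      \<le> 2 * s ^ (Suc k + 2)" if "2 + real (k + 2) * (s\<^sup>2 - 1) \<le> 2 * s ^ (k + 2)" for k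
  proof -
    have "s * (2 + real (k + 2) * (s\<^sup>2 - 1)) \<le> s * (2 * s ^ (k + 2))"
      using that assms by (intro mult_left_mono) auto
    then show ?thesis by (simp add: algebra_simps power2_eq_square)
  qed
  have pos: "0 < real (k + 2) * (s + 1) - 1" for k
  proof -
    have "1 * 1 < real (k + 2) * (s + 1)" using assms by (intro mult_strict_mono) auto
    then show ?thesis by simp
  qed
  show weak: "2 + real (k + 2) * (s\<^sup>2 - 1) \<le> 2 * s ^ (k + 2)" for k
  proof (induction k)
    case (Suc k)
    have "0 \<le> (s - 1)\<^sup>2 * (real (k + 2) * (s + 1) - 1)"
      using pos[of k] by (intro mult_nonneg_nonneg) auto
    from add_increasing2[OF this order_refl] step[OF Suc] show ?case by (rule order_trans)
  qed (simp add: power2_eq_square)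
  assume "s \<noteq> 1" "0 < k"
  then obtain k' where k: "k = Suc k'" using gr0_implies_Suc by blast
  have "0 < (s - 1)\<^sup>2 * (real (k' + 2) * (s + 1) - 1)"
    using pos[of k'] \<open>s \<noteq> 1\<close> by (intro mult_pos_pos) auto
  with step[OF weak[of k']] show "2 + real (k + 2) * (s\<^sup>2 - 1) < 2 * s ^ (k + 2)"
    unfolding k by linarith
qed

text \<open>With \<open>s i = y i / x i\<close>, the squares \<open>(x i)\<^sup>2\<close> are
  weights of total 1. Averaging the tangent bound leaves only its constant, because the weighted
  mean of \<open>(s i)\<^sup>2\<close> is 1 as well. Strictness comes from \<open>j\<close>, where
  \<open>s j\<close> differs from 1.\<close>

lemma power_sum_strict_min:
  fixes x y lam :: "'a \<Rightarrow> real"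
  assumes fin: "finite B" and m: "3 \<le> m"
    and x: "(\<Sum>i\<in>B. (x i)\<^sup>2) = 1" and y: "(\<Sum>i\<in>B. (y i)\<^sup>2) = 1"
    and sgn: "\<And>i. i \<in> B \<Longrightarrow> 0 < x i * y i"
    and crit: "\<And>i. i \<in> B \<Longrightarrow> lam i * x i ^ (m - 2) = \<mu>" and \<mu>: "0 < \<mu>"
    and j: "j \<in> B" "x j \<noteq> y j"
  shows "\<mu> < (\<Sum>i\<in>B. lam i * y i ^ m)"
proof -
  obtain k where k: "m = k + 2" "0 < k" using m by (intro that[of "m - 2"]) auto
  define s where "s i = y i / x i" for i
  have x0: "x i \<noteq> 0" if "i \<in> B" for i using sgn[OF that] by auto
  have s: "0 < s i" if "i \<in> B" for i
    using sgn[OF that] by (auto simp: s_def zero_less_mult_iff zero_less_divide_iff)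
  have ys: "y i = x i * s i" if "i \<in> B" for i using x0[OF that] by (simp add: s_def)
  have "lam i * y i ^ m = \<mu> * ((x i)\<^sup>2 * s i ^ m)" if "i \<in> B" for i
  proof -
    have "lam i * y i ^ m = (lam i * x i ^ (m - 2)) * ((x i)\<^sup>2 * s i ^ m)"
      using ys[OF that] by (simp add: k power_mult_distrib power_add power2_eq_square)
    then show ?thesis by (simp only: crit[OF that])
  qed
  then have val: "(\<Sum>i\<in>B. lam i * y i ^ m) = \<mu> * (\<Sum>i\<in>B. (x i)\<^sup>2 * s i ^ m)"
    by (simp add: sum_distrib_left)
  \<comment> \<open>The second summand is zero; it is added so that the right side becomes the
    weighted sum of the tangent lines.\<close>
  have "2 = 2 * (\<Sum>i\<in>B. (x i)\<^sup>2) + real m * ((\<Sum>i\<in>B. (y i)\<^sup>2) - (\<Sum>i\<in>B. (x i)\<^sup>2))"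
    by (simp add: x y)
  also have "\<dots> = (\<Sum>i\<in>B. (x i)\<^sup>2 * (2 + real m * ((s i)\<^sup>2 - 1)))"
    by (simp add: ys power_mult_distrib algebra_simps sum.distrib sum_distrib_left sum_subtractf)
  also have "\<dots> < (\<Sum>i\<in>B. (x i)\<^sup>2 * (2 * s i ^ m))"
  proof (rule sum_strict_mono_ex1[OF fin])
    show "\<forall>i\<in>B. (x i)\<^sup>2 * (2 + real m * ((s i)\<^sup>2 - 1)) \<le> (x i)\<^sup>2 * (2 * s i ^ m)"
      using power_tangent_at_1(1)[OF s] unfolding k(1) by (intro ballI mult_left_mono) auto
    have "s j \<noteq> 1" using j ys by auto
    then have "(x j)\<^sup>2 * (2 + real m * ((s j)\<^sup>2 - 1)) < (x j)\<^sup>2 * (2 * s j ^ m)"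
      using power_tangent_at_1(2)[OF s[OF j(1)]] k x0[OF j(1)] by (intro mult_strict_left_mono) auto
    with j(1) show "\<exists>i\<in>B. (x i)\<^sup>2 * (2 + real m * ((s i)\<^sup>2 - 1)) < (x i)\<^sup>2 * (2 * s i ^ m)" by blast
  qed
  also have "\<dots> = 2 * (\<Sum>i\<in>B. (x i)\<^sup>2 * s i ^ m)"
    by (simp add: sum_distrib_left mult_ac)
  finally have "\<mu> * 1 < \<mu> * (\<Sum>i\<in>B. (x i)\<^sup>2 * s i ^ m)" using \<mu> by (intro mult_strict_left_mono) auto
  then show ?thesis by (simp add: val)
qed

section \<open>Arcs of great circles on the unit sphere\<close>

lemma eventually_sin_nonzero: "\<forall>\<^sub>F t::real in at 0. sin t \<noteq> 0"
proof -
  have "\<forall>\<^sub>F t::real in at 0. t \<in> {-1<..<1} \<and> t \<noteq> 0"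
    using eventually_at_in_open[of "{-1<..<1}" "0::real"] by (simp add: Diff_eq)
  then show ?thesis
  proof eventually_elim
    case (elim t)
    then show ?case
      using sin_gt_zero[of t] sin_gt_zero[of "-t"] pi_gt3 by (cases "0 < t") auto
  qed
qed

lemma norm_arc:
  fixes v h :: "'a::real_inner"
  assumes "v \<bullet> v = 1" "h \<bullet> h = 1" "v \<bullet> h = 0"
  shows "norm (cos t *\<^sub>R v + sin t *\<^sub>R h) = 1"
  using assms unfolding norm_eq_1
  by (simp add: inner_simps inner_commute[of h v] power2_eq_square[symmetric])

lemma local_minimizer_on_uminus:
  "local_minimizer_on X f v \<longleftrightarrow> local_maximizer_on X (\<lambda>w. - f w) v"
  by (simp add: local_minimizer_on_def local_maximizer_on_def)

text \<open>The arc is continuous and starts at \<open>v\<close>. Where it meets \<open>v\<close>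
  the inequality is trivial, so a full neighbourhood of 0 is obtained, as the derivative test
  requires.\<close>

lemma local_maximizer_on_arc:
  fixes v h :: "'a::real_inner"
  assumes loc: "local_maximizer_on (sphere 0 1) f v" and h: "h \<bullet> h = 1" "v \<bullet> h = 0"
  shows "\<forall>\<^sub>F t in nhds 0. f (cos t *\<^sub>R v + sin t *\<^sub>R h) \<le> f v"
proof -
  have v: "v \<bullet> v = 1" using loc by (simp add: local_maximizer_on_def norm_eq_1)
  from loc obtain d where d: "0 < d"
    and le: "\<And>y. y \<in> sphere 0 1 \<Longrightarrow> y \<noteq> v \<Longrightarrow> dist y v < d \<Longrightarrow> f y \<le> f v"
    by (auto simp: local_maximizer_on_def eventually_at)
  have "isCont (\<lambda>t. cos t *\<^sub>R v + sin t *\<^sub>R h) 0" by (intro continuous_intros)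
  then have "((\<lambda>t. cos t *\<^sub>R v + sin t *\<^sub>R h) \<longlongrightarrow> v) (nhds (0::real))"
    by (simp add: isCont_def tendsto_nhds_iff)
  from tendstoD[OF this d] show ?thesis
  proof eventually_elim
    case (elim t)
    then show ?case
      using le[of "cos t *\<^sub>R v + sin t *\<^sub>R h"] norm_arc[OF v h]
      by (cases "cos t *\<^sub>R v + sin t *\<^sub>R h = v") auto
  qed
qed

lemma local_minimizer_on_arc:
  fixes v h :: "'a::real_inner"
  assumes "local_minimizer_on (sphere 0 1) f v" and "h \<bullet> h = 1" "v \<bullet> h = 0"
  shows "\<forall>\<^sub>F t in nhds 0. f v \<le> f (cos t *\<^sub>R v + sin t *\<^sub>R h)"
  using local_maximizer_on_arc[of "\<lambda>w. - f w"] assms by (simp add: local_minimizer_on_uminus)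


section \<open>Coordinates with respect to the orthonormal family\<close>

locale orthonormal_tensor =
  fixes m r :: nat and S :: "('n::finite) tensor" and lam :: "nat \<Rightarrow> real"
    and u :: "nat \<Rightarrow> real ^ 'n"
  assumes m: "3 \<le> m"
    and entries: "\<And>is. length is = m \<Longrightarrow> S is = (\<Sum>i=1..r. lam i * tensor_power (u i) is)"
    and ortho: "\<And>i j. i \<in> {1..r} \<Longrightarrow> j \<in> {1..r} \<Longrightarrow> u i \<bullet> u j = (if i = j then 1 else 0)"
    and lam_pos: "\<And>i. i \<in> {1..r} \<Longrightarrow> 0 < lam i"
begin

lemma form_eq: "tensor_form m S w = (\<Sum>i=1..r. lam i * (u i \<bullet> w) ^ m)"
proof -
  have "tensor_form m S w
      = (\<Sum>is | length is = m. \<Sum>i=1..r. lam i * (tensor_power (u i) is * (\<Prod>j\<leftarrow>is. w $ j)))"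
    unfolding tensor_form_def by (intro sum.cong) (auto simp: entries sum_distrib_right mult.assoc)
  also have "\<dots> = (\<Sum>i=1..r. lam i * (u i \<bullet> w) ^ m)"
    by (subst sum.swap) (simp add: sum_distrib_left[symmetric] sum_tensor_power_mult)
  finally show ?thesis .
qed

lemma apply_eq: "tensor_apply m S w = (\<Sum>i=1..r. (lam i * (u i \<bullet> w) ^ (m - 1)) *\<^sub>R u i)"
proof (subst vec_eq_iff, intro allI)
  fix j
  have "tensor_apply m S w $ j = (\<Sum>is | length is = m - 1. \<Sum>i=1..r.
      lam i * u i $ j * (tensor_power (u i) is * (\<Prod>j\<leftarrow>is. w $ j)))"
    unfolding tensor_apply_def using m
    by (auto simp: entries sum_distrib_right mult.assoc tensor_power_def intro!: sum.cong)
  also have "\<dots> = (\<Sum>i=1..r. lam i * u i $ j * (u i \<bullet> w) ^ (m - 1))"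
    by (subst sum.swap) (simp add: sum_distrib_left[symmetric] sum_tensor_power_mult)
  also have "\<dots> = (\<Sum>i=1..r. (lam i * (u i \<bullet> w) ^ (m - 1)) *\<^sub>R u i) $ j"
    by (simp add: mult_ac)
  finally show "tensor_apply m S w $ j = (\<Sum>i=1..r. (lam i * (u i \<bullet> w) ^ (m - 1)) *\<^sub>R u i) $ j" .
qed

lemma inner_basis_sum:
  assumes "A \<subseteq> {1..r}" "i \<in> {1..r}"
  shows "u i \<bullet> (\<Sum>j\<in>A. c j *\<^sub>R u j) = (if i \<in> A then c i else 0)"
proof -
  have "u i \<bullet> (\<Sum>j\<in>A. c j *\<^sub>R u j) = (\<Sum>j\<in>A. if i = j then c j else 0)"
    unfolding inner_sum_right by (rule sum.cong) (use assms ortho in auto)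
  then show ?thesis using finite_subset[OF assms(1)] by simp
qed

lemma inner_sums:
  assumes "A \<subseteq> {1..r}"
  shows "(\<Sum>j\<in>A. c j *\<^sub>R u j) \<bullet> (\<Sum>j\<in>A. d j *\<^sub>R u j) = (\<Sum>j\<in>A. c j * d j)"
  unfolding inner_sum_left[of _ A] using assms
  by (intro sum.cong refl) (simp, subst inner_basis_sum, auto)

lemma bessel: "(\<Sum>i=1..r. (u i \<bullet> w)\<^sup>2) \<le> w \<bullet> w"
proof -
  let ?p = "\<Sum>i=1..r. (u i \<bullet> w) *\<^sub>R u i"
  have "?p \<bullet> w = (\<Sum>i=1..r. (u i \<bullet> w)\<^sup>2)" by (simp add: inner_sum_left power2_eq_square)
  moreover have "?p \<bullet> ?p = (\<Sum>i=1..r. (u i \<bullet> w)\<^sup>2)"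
    by (simp add: inner_sums power2_eq_square)
  moreover have "0 \<le> (w - ?p) \<bullet> (w - ?p)" by simp
  ultimately show ?thesis by (simp add: inner_diff_left inner_diff_right inner_commute)
qed

lemma dim_image: "dim (u ` {1..r}) = r"
proof -
  have inj: "inj_on u {1..r}"
    by (rule inj_onI) (metis ortho zero_neq_one)
  have "pairwise orthogonal (u ` {1..r})"
  proof (unfold pairwise_def orthogonal_def, clarify)
    fix i j assume "u i \<noteq> u j" "i \<in> {1..r}" "j \<in> {1..r}"
    then show "u i \<bullet> u j = 0" using ortho[of i j] by (cases "i = j") simp_all
  qed
  moreover have "0 \<notin> u ` {1..r}" using ortho by force
  ultimately have "independent (u ` {1..r})" by (rule pairwise_orthogonal_independent)
  then show "dim (u ` {1..r}) = r"
    using inj by (simp add: dim_eq_card_independent card_image)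
qed

text \<open>The residual lies in the span and is orthogonal to it, hence to itself.\<close>

lemma span_expansion:
  assumes "w \<in> span (u ` {1..r})"
  shows "w = (\<Sum>i=1..r. (u i \<bullet> w) *\<^sub>R u i)"
proof -
  let ?p = "\<Sum>i=1..r. (u i \<bullet> w) *\<^sub>R u i"
  have "w - ?p \<in> span (u ` {1..r})"
    by (intro span_diff span_sum span_scale assms) (auto intro: span_base)
  moreover have "orthogonal (w - ?p) y" if "y \<in> u ` {1..r}" for y
  proof -
    obtain i where i: "i \<in> {1..r}" "y = u i" using \<open>y \<in> u ` {1..r}\<close> by blast
    then show ?thesis
      using inner_basis_sum[OF subset_refl i(1), of "\<lambda>i. u i \<bullet> w"]
      by (subst orthogonal_commute) (simp add: orthogonal_def inner_diff_right)
  qed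
  ultimately have "orthogonal (w - ?p) (w - ?p)"
    by (rule orthogonal_to_span)
  then show ?thesis unfolding orthogonal_self by (rule eq_iff_diff_eq_0[THEN iffD2])
qed

lemma span_sum_squares:
  assumes "w \<in> span (u ` {1..r})"
  shows "(\<Sum>i=1..r. (u i \<bullet> w)\<^sup>2) = w \<bullet> w"
proof -
  have "(\<Sum>i=1..r. (u i \<bullet> w)\<^sup>2) = (\<Sum>i=1..r. (u i \<bullet> w) *\<^sub>R u i) \<bullet> w"
    by (simp add: inner_sum_left power2_eq_square)
  then show ?thesis by (simp only: span_expansion[OF assms, symmetric])
qed

lemma full_span: "r = CARD('n) \<Longrightarrow> w \<in> span (u ` {1..r})"
  using dim_image dim_eq_full[of "u ` {1..r}"] by simp

text \<open>The form vanishes at such an \<open>h\<close>, which serves as the direction in which a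
  combination fails to be a local minimum.\<close>

lemma normal_vector_exists:
  assumes "r < CARD('n)"
  obtains h where "h \<bullet> h = 1" "\<And>i. i \<in> {1..r} \<Longrightarrow> u i \<bullet> h = 0"
proof -
  have "dim (u ` {1..r}) < DIM(real ^ 'n)" using assms by (simp only: dim_image) simp
  then obtain x where "x \<noteq> 0" and x: "\<And>y. y \<in> span (u ` {1..r}) \<Longrightarrow> orthogonal x y"
    using orthogonal_to_subspace_exists by blast
  show thesis
  proof
    show "sgn x \<bullet> sgn x = 1" using \<open>x \<noteq> 0\<close> by (simp add: norm_sgn flip: norm_eq_1)
    show "u i \<bullet> sgn x = 0" if "i \<in> {1..r}" for i
      using x[of "u i"] that by (simp add: sgn_div_norm orthogonal_def span_base inner_commute)
  qed
qed

text \<open>Pairing the eigenvector equation with \<open>u i\<close> gives the coordinate relation,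
  pairing it with \<open>v\<close> gives the value, and dividing it by \<mu> writes \<open>v\<close>
  as a combination of the \<open>u i\<close>.\<close>

lemma Z_eigenpairD:
  assumes "Z_eigenpair m S \<mu> v"
  shows Z_eigenpair_support: "i \<in> {1..r} \<Longrightarrow> u i \<bullet> v \<noteq> 0 \<Longrightarrow> lam i * (u i \<bullet> v) ^ (m - 2) = \<mu>"
    and Z_eigenpair_form: "tensor_form m S v = \<mu>"
    and Z_eigenpair_span: "\<mu> \<noteq> 0 \<Longrightarrow> v \<in> span (u ` {1..r})"
proof -
  have v: "v \<bullet> v = 1" and eig: "(\<Sum>i=1..r. (lam i * (u i \<bullet> v) ^ (m - 1)) *\<^sub>R u i) = \<mu> *\<^sub>R v"
    using assms by (auto simp: Z_eigenpair_def apply_eq)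
  have coord: "lam i * (u i \<bullet> v) ^ (m - 1) = \<mu> * (u i \<bullet> v)" if "i \<in> {1..r}" for i
    using arg_cong[OF eig, of "inner (u i)"] that by (simp add: inner_basis_sum)
  have m1: "m - 1 = Suc (m - 2)" "m = Suc (m - 1)" using m by auto
  show "lam i * (u i \<bullet> v) ^ (m - 2) = \<mu>" if "i \<in> {1..r}" "u i \<bullet> v \<noteq> 0" for i
    using coord[OF that(1)] that(2) unfolding m1(1) by simp
  have "tensor_form m S v = (\<Sum>i=1..r. (lam i * (u i \<bullet> v) ^ (m - 1)) *\<^sub>R u i) \<bullet> v"
    unfolding form_eq inner_sum_left by (subst m1(2)) (simp add: mult_ac)
  then show "tensor_form m S v = \<mu>" unfolding eig by (simp add: v)
  assume "\<mu> \<noteq> 0"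
  then have "v = (1 / \<mu>) *\<^sub>R (\<mu> *\<^sub>R v)" by simp
  also have "\<dots> \<in> span (u ` {1..r})"
    unfolding eig[symmetric] by (intro span_scale span_sum) (auto intro: span_base)
  finally show "v \<in> span (u ` {1..r})" .
qed

lemma Z_eigenpairI:
  assumes "v \<in> span (u ` {1..r})" "v \<bullet> v = 1"
    and "\<And>i. i \<in> {1..r} \<Longrightarrow> lam i * (u i \<bullet> v) ^ (m - 1) = \<mu> * (u i \<bullet> v)"
  shows "Z_eigenpair m S \<mu> v"
proof -
  have "tensor_apply m S v = \<mu> *\<^sub>R (\<Sum>i=1..r. (u i \<bullet> v) *\<^sub>R u i)"
    unfolding apply_eq scaleR_sum_right by (rule sum.cong) (use assms(3) in auto)
  then show ?thesis
    using assms(2) by (simp only: span_expansion[OF assms(1), symmetric] Z_eigenpair_def)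
qed

text \<open>In each coordinate at most one of the two summands is nonzero, so the
  \<open>m\<close>-th power has no mixed terms.\<close>

lemma tensor_form_arc:
  assumes "\<And>i. i \<in> {1..r} \<Longrightarrow> (u i \<bullet> v) * (u i \<bullet> h) = 0"
  shows "tensor_form m S (a *\<^sub>R v + b *\<^sub>R h)
    = a ^ m * tensor_form m S v + b ^ m * tensor_form m S h"
proof -
  have "lam i * (u i \<bullet> (a *\<^sub>R v + b *\<^sub>R h)) ^ m
      = a ^ m * (lam i * (u i \<bullet> v) ^ m) + b ^ m * (lam i * (u i \<bullet> h) ^ m)" if "i \<in> {1..r}" for i
    using assms[OF that] m by (auto simp: inner_simps power_mult_distrib)
  then show ?thesis by (simp add: form_eq sum.distrib sum_distrib_left)
qed

section \<open>Local extrema and stationary points\<close>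

text \<open>The factor \<open>s\<close> treats maxima (\<open>s = 1\<close>) and minima
  (\<open>s = -1\<close>) together. The derivative along every arc through \<open>v\<close>
  vanishes; choosing the arc in the direction of the tangential part \<open>p\<close> of
  \<open>G\<close> forces \<open>p = 0\<close>.\<close>

lemma local_maximizer_imp_Z_eigenpair:
  assumes max: "local_maximizer_on (sphere 0 1) (\<lambda>w. s * tensor_form m S w) v" and s: "s \<noteq> 0"
  obtains \<mu> where "Z_eigenpair m S \<mu> v"
proof -
  define G where "G = tensor_apply m S v"
  define p where "p = G - (G \<bullet> v) *\<^sub>R v"
  have v: "v \<bullet> v = 1" using max by (simp add: local_maximizer_on_def norm_eq_1)
  have "G \<bullet> h = 0" if h: "h \<bullet> h = 1" "v \<bullet> h = 0" for h
  proof -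
    let ?g = "\<lambda>t. s * tensor_form m S (cos t *\<^sub>R v + sin t *\<^sub>R h)"
    have "(?g has_real_derivative s * (real m * (G \<bullet> h))) (at 0)"
      unfolding form_eq inner_add_right inner_scaleR_right G_def apply_eq inner_sum_left sum_distrib_left
      by (auto intro!: derivative_eq_intros sum.cong simp: mult_ac)
    moreover obtain d where "0 < d" "\<And>t. \<bar>t\<bar> < d \<Longrightarrow> ?g t \<le> ?g 0"
      using local_maximizer_on_arc[OF max h] by (auto simp: eventually_nhds_metric)
    ultimately have "s * (real m * (G \<bullet> h)) = 0" by (intro DERIV_local_max[of ?g _ 0 d]) auto
    then show ?thesis using s m by simp
  qed
  moreover have vp: "v \<bullet> p = 0" by (simp add: p_def inner_diff_right v inner_commute)
  ultimately have "G \<bullet> sgn p = 0" if "p \<noteq> 0"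
    using that by (metis norm_eq_1 norm_sgn inner_scaleR_right mult_zero_right sgn_div_norm)
  then have "p \<bullet> p = 0"
    using vp by (cases "p = 0") (simp_all add: p_def inner_diff_left sgn_div_norm)
  then have "Z_eigenpair m S (G \<bullet> v) v" by (simp add: Z_eigenpair_def v G_def p_def)
  then show thesis by (rule that)
qed

lemma local_extremum_imp_Z_eigenpair:
  assumes "local_maximizer_on (sphere 0 1) (tensor_form m S) v
    \<or> local_minimizer_on (sphere 0 1) (tensor_form m S) v"
  obtains \<mu> where "Z_eigenpair m S \<mu> v"
  using assms local_maximizer_imp_Z_eigenpair[of 1 v] local_maximizer_imp_Z_eigenpair[of "-1" v]
  by (auto simp: local_minimizer_on_uminus)

text \<open>The form on the arc is \<open>cos t ^ m * \<mu> + sin t ^ m * tensor_form m S h\<close>.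
  The first term is at most \<open>(cos t)\<^sup>2 * \<mu>\<close>. Since
  \<open>sin t ^ (m - 2)\<close> tends to 0, the second is eventually below
  \<open>(sin t)\<^sup>2 * \<mu>\<close>, whatever the value at \<open>h\<close>.\<close>

lemma not_local_minimizer:
  assumes eig: "Z_eigenpair m S \<mu> v" and \<mu>: "0 < \<mu>" and h: "h \<bullet> h = 1" "v \<bullet> h = 0"
    and disj: "\<And>i. i \<in> {1..r} \<Longrightarrow> (u i \<bullet> v) * (u i \<bullet> h) = 0"
  shows "\<not> local_minimizer_on (sphere 0 1) (tensor_form m S) v"
proof
  have arc: "tensor_form m S (cos t *\<^sub>R v + sin t *\<^sub>R h)
      = cos t ^ m * \<mu> + sin t ^ m * tensor_form m S h" for t
    using tensor_form_arc[of v h] disj Z_eigenpair_form[OF eig] by simp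
  assume "local_minimizer_on (sphere 0 1) (tensor_form m S) v"
  from local_minimizer_on_arc[OF this h]
  have "\<forall>\<^sub>F t in at 0. \<mu> \<le> cos t ^ m * \<mu> + sin t ^ m * tensor_form m S h"
    by (auto simp: arc Z_eigenpair_form[OF eig] eventually_at_filter elim: eventually_mono)
  moreover have "\<forall>\<^sub>F t in at 0. sin t ^ (m - 2) * tensor_form m S h < \<mu>"
    using \<mu> m by (intro order_tendstoD(2)[of _ 0]) (auto intro!: tendsto_eq_intros)
  moreover have "\<forall>\<^sub>F t::real in at 0. 0 < cos t"
    by (rule order_tendstoD(1)[of _ 1]) (auto intro!: tendsto_eq_intros)
  moreover note eventually_sin_nonzero
  ultimately have "\<forall>\<^sub>F t::real in at 0. False"
  proof eventually_elim
    case (elim t)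
    have m2: "2 + (m - 2) = m" using m by simp
    have "cos t ^ m * \<mu> \<le> (cos t)\<^sup>2 * \<mu>"
      using elim(3) m \<mu> by (intro mult_right_mono power_decreasing) auto
    moreover have "sin t ^ m * tensor_form m S h = (sin t)\<^sup>2 * (sin t ^ (m - 2) * tensor_form m S h)"
      using power_add[of "sin t" 2 "m - 2"] by (simp only: m2 mult.assoc)
    moreover have "\<dots> < (sin t)\<^sup>2 * \<mu>"
      using elim(2,4) by (intro mult_strict_left_mono) auto
    moreover have "(cos t)\<^sup>2 * \<mu> + (sin t)\<^sup>2 * \<mu> = \<mu>" by (simp flip: distrib_right)
    ultimately show False using elim(1) by linarith
  qed
  then show False by simp
qed


text \<open>The factor \<open>\<mu>\<close> covers both signs: for \<open>\<mu> < 0\<close> this says that \<open>v\<close> is not a local minimizer.\<close>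

lemma not_local_maximizer:
  assumes eig: "Z_eigenpair m S \<mu> v" and \<mu>: "\<mu> \<noteq> 0"
    and ij: "i \<in> {1..r}" "j \<in> {1..r}" "i \<noteq> j" "u i \<bullet> v \<noteq> 0" "u j \<bullet> v \<noteq> 0"
  shows "\<not> local_maximizer_on (sphere 0 1) (\<lambda>w. \<mu> * tensor_form m S w) v"
proof
  assume max: "local_maximizer_on (sphere 0 1) (\<lambda>w. \<mu> * tensor_form m S w) v"
  define B where "B = {k \<in> {1..r}. u k \<bullet> v \<noteq> 0}"
  \<comment> \<open>A vector orthogonal to \<open>v\<close> in the plane of \<open>u i\<close> and
    \<open>u j\<close>: the arc towards it keeps the coordinates outside \<open>B\<close> equal to
    0.\<close>
  define h0 where "h0 = (u j \<bullet> v) *\<^sub>R u i - (u i \<bullet> v) *\<^sub>R u j"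
  define h where "h = sgn h0"
  define w where "w t = cos t *\<^sub>R v + sin t *\<^sub>R h" for t
  have v: "v \<bullet> v = 1" and v_span: "v \<in> span (u ` {1..r})"
    using eig Z_eigenpair_span[OF eig \<mu>] by (simp_all add: Z_eigenpair_def)
  have "u i \<bullet> h0 = u j \<bullet> v" using ij(1-3) by (simp add: h0_def inner_diff_right ortho)
  then have "h0 \<noteq> 0" using ij(5) by auto
  then have h: "h \<bullet> h = 1" by (simp add: h_def norm_sgn flip: norm_eq_1)
  have vh: "v \<bullet> h = 0"
    by (simp add: h_def sgn_div_norm h0_def inner_diff_right inner_commute[of v])
  have h_span: "h \<in> span (u ` {1..r})"
    unfolding h_def sgn_div_norm h0_def using ij
    by (intro span_scale span_diff) (auto intro: span_base)
  have h_off: "u k \<bullet> h = 0" if "k \<in> {1..r}" "k \<notin> B" for k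
  proof -
    have "k \<noteq> i" "k \<noteq> j" using that ij by (auto simp: B_def)
    then show ?thesis using that(1) ij(1,2)
      by (simp add: h_def sgn_div_norm h0_def inner_diff_right ortho)
  qed
  have B: "finite B" "B \<subseteq> {1..r}" by (auto simp: B_def)
  have off: "u k \<bullet> w t = 0" if "k \<in> {1..r} - B" for k t
    using that h_off by (auto simp: w_def inner_add_right B_def)
  have w_span: "w t \<in> span (u ` {1..r})" for t
    unfolding w_def by (intro span_add span_scale v_span h_span)
  have sumB: "(\<Sum>k\<in>B. (u k \<bullet> w t)\<^sup>2) = 1" for t
  proof -
    have "(\<Sum>k\<in>B. (u k \<bullet> w t)\<^sup>2) = (\<Sum>k=1..r. (u k \<bullet> w t)\<^sup>2)"
      by (rule sum.mono_neutral_left) (use B off in auto)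
    also have "\<dots> = w t \<bullet> w t" by (rule span_sum_squares[OF w_span])
    also have "\<dots> = 1" using norm_arc[OF v h vh, of t] by (simp add: w_def norm_eq_1)
    finally show ?thesis .
  qed
  have formB: "tensor_form m S (w t) = (\<Sum>k\<in>B. lam k * (u k \<bullet> w t) ^ m)" for t
    unfolding form_eq by (rule sum.mono_neutral_right) (use B off m in auto)
  have w0: "w 0 = v" by (simp add: w_def)
  have "\<forall>\<^sub>F t in at 0. \<mu> * tensor_form m S (w t) \<le> \<mu> * \<mu>"
    using local_maximizer_on_arc[OF max h vh]
    by (simp add: Z_eigenpair_form[OF eig] eventually_at_filter w_def eventually_mono)
  moreover have "\<forall>\<^sub>F t in at 0. \<forall>k\<in>B. 0 < (u k \<bullet> v) * (u k \<bullet> w t)"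
  proof (intro eventually_ball_finite[OF B(1)] ballI)
    fix k assume "k \<in> B"
    have "((\<lambda>t. (u k \<bullet> v) * (u k \<bullet> w t)) \<longlongrightarrow> (u k \<bullet> v) * (u k \<bullet> v)) (at 0)"
      unfolding w_def by (auto intro!: tendsto_eq_intros)
    moreover have "0 < (u k \<bullet> v) * (u k \<bullet> v)"
      using \<open>k \<in> B\<close> by (auto simp: B_def zero_less_mult_iff)
    ultimately show "\<forall>\<^sub>F t in at 0. 0 < (u k \<bullet> v) * (u k \<bullet> w t)"
      by (rule order_tendstoD(1))
  qed
  moreover note eventually_sin_nonzero
  ultimately have "\<forall>\<^sub>F t::real in at 0. False"
  proof eventually_elim
    case (elim t)
    have "w t \<noteq> v"
    proof
      assume "w t = v"
      then have "w t \<bullet> h = 0" using vh by simp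
      then show False using elim(3) by (simp add: w_def inner_add_left vh h)
    qed
    then obtain k where k: "k \<in> {1..r}" "u k \<bullet> v \<noteq> u k \<bullet> w t"
      using span_expansion[OF v_span] span_expansion[OF w_span[of t]]
      by (metis (no_types, lifting) sum.cong)
    then have "k \<in> B" using off[of k t] by (auto simp: B_def)
    \<comment> \<open>With coefficients \<open>\<mu> * lam k\<close> the critical value becomes
      \<open>\<mu> * \<mu>\<close>, which is positive for either sign of \<mu>.\<close>
    have "\<mu> * \<mu> < (\<Sum>k\<in>B. (\<mu> * lam k) * (u k \<bullet> w t) ^ m)"
    proof (rule power_sum_strict_min[where x = "\<lambda>k. u k \<bullet> v" and y = "\<lambda>k. u k \<bullet> w t",
          OF B(1) m _ sumB _ _ _ \<open>k \<in> B\<close> k(2)])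
      show "(\<Sum>k\<in>B. (u k \<bullet> v)\<^sup>2) = 1" using sumB[of 0] by (simp add: w0)
      show "0 < (u k \<bullet> v) * (u k \<bullet> w t)" if "k \<in> B" for k using elim(2) that by blast
      show "\<mu> * lam k * (u k \<bullet> v) ^ (m - 2) = \<mu> * \<mu>" if "k \<in> B" for k
        using Z_eigenpair_support[OF eig, of k] that by (simp add: B_def mult.assoc)
      show "0 < \<mu> * \<mu>" using \<mu> by (auto simp: zero_less_mult_iff)
    qed
    also have "\<dots> = \<mu> * tensor_form m S (w t)"
      by (simp add: formB sum_distrib_left mult.assoc)
    finally show False using elim(1) by simp
  qed
  then show False by simp
qed

text \<open>Points near \<open>v\<close> share its coordinate signs, so the power inequality makes
  \<open>v\<close> a strict minimum. Another local minimizer nearby would be stationary with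
  positive value and the same signs, and the inequality with the roles exchanged gives a
  contradiction.\<close>

lemma full_support_isolated_min:
  assumes full: "r = CARD('n)" and eig: "Z_eigenpair m S \<mu> v" and \<mu>: "0 < \<mu>"
    and supp: "\<And>i. i \<in> {1..r} \<Longrightarrow> u i \<bullet> v \<noteq> 0"
  shows "isolated_local_min_solution m S \<mu> v"
proof -
  \<comment> \<open>Stated for an arbitrary eigenpair, since it is applied both to \<open>v\<close>
    and to a competing minimizer.\<close>
  have less: "\<nu> < tensor_form m S w"
    if "Z_eigenpair m S \<nu> x" "0 < \<nu>" "w \<bullet> w = 1" and neq: "w \<noteq> x"
      and sgn: "\<And>i. i \<in> {1..r} \<Longrightarrow> 0 < (u i \<bullet> x) * (u i \<bullet> w)" for \<nu> x w
  proof -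
    obtain k where k: "k \<in> {1..r}" "u k \<bullet> x \<noteq> u k \<bullet> w"
      using span_expansion[OF full_span[OF full], of x] span_expansion[OF full_span[OF full], of w]
        neq
      by (metis (no_types, lifting) sum.cong)
    have "x \<bullet> x = 1" using that(1) by (simp add: Z_eigenpair_def)
    moreover have "lam i * (u i \<bullet> x) ^ (m - 2) = \<nu>" if "i \<in> {1..r}" for i
      using Z_eigenpair_support[OF \<open>Z_eigenpair m S \<nu> x\<close> that] sgn[OF that] mult_zero_left[of "u i \<bullet> w"]
      by (metis less_irrefl)
    ultimately show ?thesis
      unfolding form_eq using m sgn k that
      by (intro power_sum_strict_min[of _ m "\<lambda>i. u i \<bullet> x" "\<lambda>i. u i \<bullet> w" lam \<nu> k])
        (simp_all only: span_sum_squares[OF full_span[OF full]] finite_atLeastAtMost not_False_eq_True)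
  qed
  have v: "v \<bullet> v = 1" using eig by (simp add: Z_eigenpair_def)
  have near: "\<forall>\<^sub>F w in at v within sphere 0 1. \<forall>i\<in>{1..r}. 0 < (u i \<bullet> v) * (u i \<bullet> w)"
  proof (intro eventually_ball_finite ballI)
    fix i assume "i \<in> {1..r}"
    then have "0 < (u i \<bullet> v) * (u i \<bullet> v)" using supp[of i] by (auto simp: zero_less_mult_iff)
    then show "\<forall>\<^sub>F w in at v within sphere 0 1. 0 < (u i \<bullet> v) * (u i \<bullet> w)"
      by (rule order_tendstoD(1)[rotated]) (intro tendsto_intros)
  qed simp
  have sphere: "\<forall>\<^sub>F w in at v within sphere 0 1. w \<in> sphere 0 1 \<and> w \<noteq> v"
    by (simp add: eventually_at_filter)
  from near sphere have "\<forall>\<^sub>F w in at v within sphere 0 1.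
    \<mu> \<le> tensor_form m S w \<and> \<not> local_minimizer_on (sphere 0 1) (tensor_form m S) w"
  proof eventually_elim
    case (elim w)
    then have w: "w \<bullet> w = 1" "w \<noteq> v" by (auto simp: norm_eq_1)
    have lt: "\<mu> < tensor_form m S w" using less[OF eig \<mu> w] elim(1) by blast
    moreover have False if "local_minimizer_on (sphere 0 1) (tensor_form m S) w"
    proof -
      obtain \<nu> where \<nu>: "Z_eigenpair m S \<nu> w"
        using local_extremum_imp_Z_eigenpair \<open>local_minimizer_on _ _ w\<close> by blast
      have "0 < \<nu>" using lt \<mu> Z_eigenpair_form[OF \<nu>] by simp
      then have "\<nu> < tensor_form m S v"
        using less[OF \<nu> _ v] w(2) elim(1) by (simp add: mult.commute)
      then show False using lt Z_eigenpair_form[OF \<nu>] Z_eigenpair_form[OF eig] by simp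
    qed
    ultimately show ?case by auto
  qed
  then show ?thesis
    using eig v Z_eigenpair_form[OF eig]
    by (auto simp: isolated_local_min_solution_def local_minimizer_on_def norm_eq_1
        elim: eventually_mono)
qed

lemma basis_isolated_max:
  assumes i: "i \<in> {1..r}"
  shows "isolated_local_max_solution m S (lam i) (u i)"
proof -
  have ui: "u i \<bullet> u i = 1" using i by (simp add: ortho)
  have eig: "Z_eigenpair m S (lam i) (u i)"
  proof (rule Z_eigenpairI[OF _ ui])
    show "u i \<in> span (u ` {1..r})" using i by (auto intro: span_base)
    show "lam j * (u j \<bullet> u i) ^ (m - 1) = lam i * (u j \<bullet> u i)" if "j \<in> {1..r}" for j
      using ortho[OF that i] m by simp
  qed
  let ?F = "at (u i) within sphere 0 1"
  have coord: "((\<lambda>w. u j \<bullet> w) \<longlongrightarrow> u j \<bullet> u i) ?F" for j by (intro tendsto_intros)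
  \<comment> \<open>The absolute value covers odd \<open>m\<close>, where the powers of negative
    coordinates are negative.\<close>
  have "\<forall>\<^sub>F w in ?F. \<forall>j\<in>{1..r} - {i}. lam j * \<bar>u j \<bullet> w\<bar> ^ (m - 2) < lam i * (u i \<bullet> w) ^ (m - 2)"
  proof (intro eventually_ball_finite ballI)
    fix j assume j: "j \<in> {1..r} - {i}"
    have "((\<lambda>w. lam i * (u i \<bullet> w) ^ (m - 2) - lam j * \<bar>u j \<bullet> w\<bar> ^ (m - 2))
      \<longlongrightarrow> lam i * (u i \<bullet> u i) ^ (m - 2) - lam j * \<bar>u j \<bullet> u i\<bar> ^ (m - 2)) ?F"
      by (intro tendsto_intros)
    moreover have "0 < lam i * (u i \<bullet> u i) ^ (m - 2) - lam j * \<bar>u j \<bullet> u i\<bar> ^ (m - 2)"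
      using j i m lam_pos[OF i] by (simp add: ortho power_0_left)
    ultimately have "\<forall>\<^sub>F w in ?F. 0 < lam i * (u i \<bullet> w) ^ (m - 2) - lam j * \<bar>u j \<bullet> w\<bar> ^ (m - 2)"
      by (rule order_tendstoD(1))
    then show "\<forall>\<^sub>F w in ?F. lam j * \<bar>u j \<bullet> w\<bar> ^ (m - 2) < lam i * (u i \<bullet> w) ^ (m - 2)"
      by simp
  qed simp
  moreover have "\<forall>\<^sub>F w in ?F. 0 < u i \<bullet> w"
    using coord[of i] by (rule order_tendstoD(1)) (simp add: ui)
  moreover have "\<forall>\<^sub>F w in ?F. w \<in> sphere 0 1 \<and> w \<noteq> u i"
    by (simp add: eventually_at_filter)
  ultimately have "\<forall>\<^sub>F w in ?F. tensor_form m S w \<le> lam i \<and>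
    \<not> local_maximizer_on (sphere 0 1) (tensor_form m S) w"
  proof eventually_elim
    case (elim w)
    have w: "w \<bullet> w = 1" using elim(3) by (simp add: norm_eq_1)
    have "(u i \<bullet> w)\<^sup>2 \<le> (\<Sum>j=1..r. (u j \<bullet> w)\<^sup>2)" using i by (intro member_le_sum) auto
    then have "(u i \<bullet> w)\<^sup>2 \<le> 1" using bessel[of w] w by linarith
    then have le1: "u i \<bullet> w \<le> 1" using abs_square_le_1[of "u i \<bullet> w"] by auto
    \<comment> \<open>A termwise comparison with a quadratic form, to which Bessel's inequality
      applies.\<close>
    have term_le: "lam j * (u j \<bullet> w) ^ m \<le> lam i * (u j \<bullet> w)\<^sup>2" if j: "j \<in> {1..r}" for j
    proof -
      have "lam j * \<bar>u j \<bullet> w\<bar> ^ (m - 2) \<le> lam i * (u i \<bullet> w) ^ (m - 2)"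
        using elim(1,2) j by (cases "j = i") (auto intro: less_imp_le)
      also have "\<dots> \<le> lam i"
        using elim(2) le1 lam_pos[OF i] by (simp add: mult_left_le power_le_one)
      finally have "lam j * \<bar>u j \<bullet> w\<bar> ^ (m - 2) * \<bar>u j \<bullet> w\<bar>\<^sup>2 \<le> lam i * \<bar>u j \<bullet> w\<bar>\<^sup>2"
        by (rule mult_right_mono) simp
      moreover have m2: "m - 2 + 2 = m" using m by simp
      ultimately have "lam j * \<bar>u j \<bullet> w\<bar> ^ m \<le> lam i * (u j \<bullet> w)\<^sup>2"
        using power_add[of "\<bar>u j \<bullet> w\<bar>" "m - 2" 2]
        by (simp only: mult.assoc power2_abs m2)
      moreover have "lam j * (u j \<bullet> w) ^ m \<le> lam j * \<bar>u j \<bullet> w\<bar> ^ m"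
        using lam_pos[OF j] by (intro mult_left_mono) (auto simp flip: power_abs)
      ultimately show ?thesis by linarith
    qed
    have "tensor_form m S w \<le> lam i * (\<Sum>j=1..r. (u j \<bullet> w)\<^sup>2)"
      unfolding form_eq sum_distrib_left by (rule sum_mono[OF term_le])
    also have "\<dots> \<le> lam i * 1"
      using bessel[of w] w lam_pos[OF i] by (intro mult_left_mono) auto
    finally have "tensor_form m S w \<le> lam i" by simp
    moreover have False if "local_maximizer_on (sphere 0 1) (tensor_form m S) w"
    proof -
      obtain \<nu> where \<nu>: "Z_eigenpair m S \<nu> w"
        using local_extremum_imp_Z_eigenpair \<open>local_maximizer_on _ _ w\<close> by blast
      have \<nu>_eq: "lam i * (u i \<bullet> w) ^ (m - 2) = \<nu>"
        using Z_eigenpair_support[OF \<nu> i] elim(2) by simp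
      then have "0 < \<nu>" using elim(2) lam_pos[OF i] by auto
      then have span: "w \<in> span (u ` {1..r})" using Z_eigenpair_span[OF \<nu>] by simp
      \<comment> \<open>Once the other coordinates vanish, \<open>w\<close> is a unit multiple of
        \<open>u i\<close> with positive coordinate, hence \<open>u i\<close> itself, which the
        punctured neighbourhood excludes.\<close>
      have zero: "u j \<bullet> w = 0" if j: "j \<in> {1..r} - {i}" for j
      proof (rule ccontr)
        assume "u j \<bullet> w \<noteq> 0"
        then have "lam j * (u j \<bullet> w) ^ (m - 2) = \<nu>" using Z_eigenpair_support[OF \<nu>] j by simp
        moreover have "lam j * (u j \<bullet> w) ^ (m - 2) \<le> lam j * \<bar>u j \<bullet> w\<bar> ^ (m - 2)"
          using lam_pos[of j] j by (intro mult_left_mono) (auto simp flip: power_abs)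
        ultimately show False using elim(1) j \<nu>_eq by force
      qed
      have w_eq: "w = (u i \<bullet> w) *\<^sub>R u i"
      proof -
        have "w = (\<Sum>j=1..r. (u j \<bullet> w) *\<^sub>R u j)" by (rule span_expansion[OF span])
        also have "\<dots> = (\<Sum>j\<in>{i}. (u j \<bullet> w) *\<^sub>R u j)"
          by (rule sum.mono_neutral_right) (use i zero in auto)
        finally show ?thesis by simp
      qed
      have "(u i \<bullet> w)\<^sup>2 = 1"
        using w inner_scaleR_left[of "u i \<bullet> w" "u i" w]
        by (simp only: w_eq[symmetric] power2_eq_square)
      then have "u i \<bullet> w = 1" using elim(2) by (simp add: power2_eq_1_iff)
      then show False using w_eq elim(3) by simp
    qed
    ultimately show ?case by auto
  qed
  then show ?thesis
    using eig ui Z_eigenpair_form[OF eig]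
    by (auto simp: isolated_local_max_solution_def local_maximizer_on_def norm_eq_1
        elim: eventually_mono)
qed

section \<open>Linear combinations of basic eigenpairs\<close>

text \<open>The coordinates of \<open>v\<close> are \<open>c i / l\<close> on \<open>A\<close> and 0
  elsewhere. The root condition on \<open>c i\<close> makes
  \<open>lam i * (c i / l) ^ (m - 2)\<close> the same number \<open>1 / l ^ (m - 2)\<close> for all
  \<open>i\<close> in \<open>A\<close>.\<close>

lemma eigenpair_combinationD:
  assumes A: "A \<subseteq> {1..r}" "A \<noteq> {}" and comb: "eigenpair_combination m lam u A \<mu> v"
  shows eigenpair_combination_eigenpair: "Z_eigenpair m S \<mu> v"
    and eigenpair_combination_pos: "0 < \<mu>"
    and eigenpair_combination_support: "i \<in> {1..r} \<Longrightarrow> u i \<bullet> v \<noteq> 0 \<longleftrightarrow> i \<in> A"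
proof -
  obtain c l where c: "\<And>i. i \<in> A \<Longrightarrow> c i ^ (m - 2) = 1 / lam i"
    and l: "l = sqrt (\<Sum>i\<in>A. (c i)\<^sup>2)"
    and v: "v = (1 / l) *\<^sub>R (\<Sum>i\<in>A. c i *\<^sub>R u i)" and \<mu>: "\<mu> = 1 / l ^ (m - 2)"
    using comb unfolding eigenpair_combination_def by blast
  have c0: "c i \<noteq> 0" if "i \<in> A" for i
  proof -
    have "c i ^ (m - 2) \<noteq> 0" using c[OF that] lam_pos[of i] A(1) that by auto
    then show ?thesis using m by (auto simp: power_0_left)
  qed
  have "finite A" using A(1) finite_subset by blast
  then have sum_pos: "0 < (\<Sum>i\<in>A. (c i)\<^sup>2)" using A(2) c0 by (intro sum_pos) auto
  then have "0 < l" by (simp add: l)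
  have l2: "l\<^sup>2 = (\<Sum>i\<in>A. (c i)\<^sup>2)" using sum_pos by (simp add: l)
  show "0 < \<mu>" using \<open>0 < l\<close> by (simp add: \<mu>)
  have coord: "u i \<bullet> v = (if i \<in> A then c i / l else 0)" if "i \<in> {1..r}" for i
    using that by (simp add: v inner_basis_sum[OF A(1)])
  show "u i \<bullet> v \<noteq> 0 \<longleftrightarrow> i \<in> A" if "i \<in> {1..r}" for i
    using coord[OF that] c0 \<open>0 < l\<close> by auto
  show "Z_eigenpair m S \<mu> v"
  proof (rule Z_eigenpairI)
    show "v \<in> span (u ` {1..r})"
      unfolding v using A(1) by (intro span_scale span_sum) (auto intro: span_base)
    have "v \<bullet> v = (\<Sum>i\<in>A. (c i)\<^sup>2) / l\<^sup>2"
      by (simp add: v inner_sums[OF A(1)] power2_eq_square)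
    then show "v \<bullet> v = 1" using \<open>0 < l\<close> by (simp flip: l2)
    fix i assume i: "i \<in> {1..r}"
    have m1: "m - 1 = Suc (m - 2)" using m by simp
    show "lam i * (u i \<bullet> v) ^ (m - 1) = \<mu> * (u i \<bullet> v)"
    proof (cases "i \<in> A")
      case True
      have "lam i * c i ^ (m - 2) = 1" using c[OF True] lam_pos[OF i] by simp
      then have "lam i * (c i / l) ^ (m - 2) = \<mu>" by (simp add: power_divide \<mu>)
      then show ?thesis using True by (simp only: coord[OF i] m1 power_Suc2 if_True flip: mult.assoc)
    qed (simp only: coord[OF i] m1 if_False power_Suc2 mult_zero_right)
  qed
qed

lemma eigenpair_combinationI:
  assumes eig: "Z_eigenpair m S \<mu> v" and \<mu>: "0 < \<mu>"
    and supp: "\<And>i. i \<in> {1..r} \<Longrightarrow> u i \<bullet> v \<noteq> 0"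
  shows "eigenpair_combination m lam u {1..r} \<mu> v"
proof -
  \<comment> \<open>From \<open>\<mu> = 1 / l ^ (m - 2)\<close> the witnesses are forced:
    \<open>l = 1 / d\<close> and \<open>c i = (u i \<bullet> v) / d\<close>.\<close>
  define d where "d = root (m - 2) \<mu>"
  have d: "0 < d" "d ^ (m - 2) = \<mu>" using m \<mu> by (auto simp: d_def)
  have span: "v \<in> span (u ` {1..r})" using Z_eigenpair_span[OF eig] \<mu> by simp
  have "v \<bullet> v = 1" using eig by (simp add: Z_eigenpair_def)
  then have sq: "(\<Sum>i=1..r. (u i \<bullet> v)\<^sup>2) = 1" using span_sum_squares[OF span] by simp
  show ?thesis
    unfolding eigenpair_combination_def
  proof (intro exI conjI ballI)
    fix i assume i: "i \<in> {1..r}"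
    show "((u i \<bullet> v) / d) ^ (m - 2) = 1 / lam i"
      using Z_eigenpair_support[OF eig i supp[OF i]] d \<mu> lam_pos[OF i]
      by (auto simp: power_divide field_simps)
  next
    have "(\<Sum>i=1..r. ((u i \<bullet> v) / d)\<^sup>2) = (\<Sum>i=1..r. (u i \<bullet> v)\<^sup>2) / d\<^sup>2"
      by (simp add: power_divide sum_divide_distrib)
    then show "1 / d = sqrt (\<Sum>i=1..r. ((u i \<bullet> v) / d)\<^sup>2)"
      unfolding sq using d(1) by (simp add: real_sqrt_divide)
    have "(\<Sum>i=1..r. ((u i \<bullet> v) / d) *\<^sub>R u i) = (1 / d) *\<^sub>R v"
      by (subst (2) span_expansion[OF span]) (simp add: scaleR_sum_right)
    then show "v = (1 / (1 / d)) *\<^sub>R (\<Sum>i=1..r. ((u i \<bullet> v) / d) *\<^sub>R u i)"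
      using d(1) by simp
    show "\<mu> = 1 / (1 / d) ^ (m - 2)" using d by (simp add: power_divide)
  qed
qed

text \<open>Two indices of \<open>A\<close> give an arc inside the span on which the form increases;
  a unit normal to the span gives one on which it decreases.\<close>

lemma eigenpair_combination_saddle:
  assumes A: "A \<subseteq> {1..r}" "1 < card A" and r: "r < CARD('n)"
    and comb: "eigenpair_combination m lam u A \<mu> v"
  shows "saddle_point_solution m S \<mu> v"
proof -
  have "A \<noteq> {}" using A(2) by auto
  note D = eigenpair_combinationD[OF A(1) this comb]
  have v_span: "v \<in> span (u ` {1..r})" using Z_eigenpair_span[OF D(1)] D(2) by simp
  obtain i j where ij: "i \<in> A" "j \<in> A" "i \<noteq> j"
    using A(2) by (metis card_le_Suc0_iff_eq card.infinite not_less One_nat_def zero_less_one less_asym)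
  moreover from ij A(1) have "i \<in> {1..r}" "j \<in> {1..r}" by auto
  ultimately have "\<not> local_maximizer_on (sphere 0 1) (\<lambda>w. \<mu> * tensor_form m S w) v"
    using D by (intro not_local_maximizer[of \<mu> v i j]) simp_all
  then have "\<not> local_maximizer_on (sphere 0 1) (tensor_form m S) v"
    using D(2) by (simp add: local_maximizer_on_def)
  moreover obtain h where h: "h \<bullet> h = 1" "\<And>i. i \<in> {1..r} \<Longrightarrow> u i \<bullet> h = 0"
    using normal_vector_exists[OF r] by blast
  have "orthogonal h v"
    by (rule orthogonal_to_span[OF v_span]) (use h(2) in \<open>auto simp: orthogonal_def inner_commute\<close>)
  then have "\<not> local_minimizer_on (sphere 0 1) (tensor_form m S) v"
    using h by (intro not_local_minimizer[OF D(1,2) h(1)]) (auto simp: orthogonal_def inner_commute)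
  ultimately show ?thesis using D(1) by (simp add: saddle_point_solution_def)
qed

text \<open>For positive \<mu>, a vanishing coordinate \<open>j\<close> would make
  \<open>u j\<close> a direction of descent, so the support is full. For negative \<mu>,
  \<open>v\<close> maximizes \<mu> times the form locally, so only one coordinate is nonzero; the
  sign of \<mu> makes it -1 and \<open>m\<close> odd.\<close>

lemma local_minimizer_classification:
  assumes full: "r = CARD('n)" and eig: "Z_eigenpair m S \<mu> v"
    and min: "local_minimizer_on (sphere 0 1) (tensor_form m S) v"
  shows "eigenpair_combination m lam u {1..r} \<mu> v \<or>
    odd m \<and> (\<exists>i\<in>{1..r}. \<mu> = - lam i \<and> v = - u i)"
proof -
  have v: "v \<bullet> v = 1" using eig by (simp add: Z_eigenpair_def)
  note exp = span_expansion[OF full_span[OF full], of v]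
  have "v \<noteq> 0" using v by auto
  \<comment> \<open>The family is a basis here, so some coordinate is nonzero; this rules out
    \<open>\<mu> = 0\<close>.\<close>
  then obtain i where i: "i \<in> {1..r}" "u i \<bullet> v \<noteq> 0"
    using exp by (metis (no_types, lifting) scaleR_eq_0_iff sum.neutral)
  have \<mu>_eq: "lam i * (u i \<bullet> v) ^ (m - 2) = \<mu>" by (rule Z_eigenpair_support[OF eig i])
  then have "\<mu> \<noteq> 0" using i lam_pos[OF i(1)] by auto
  then consider "0 < \<mu>" | "\<mu> < 0" by linarith
  then show ?thesis
  proof cases
    case 1
    have "u j \<bullet> v \<noteq> 0" if j: "j \<in> {1..r}" for j
    proof
      assume "u j \<bullet> v = 0"
      then have "(u k \<bullet> v) * (u k \<bullet> u j) = 0" if "k \<in> {1..r}" for k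
        using ortho[OF that j] by auto
      then show False
        using not_local_minimizer[OF eig 1, of "u j"] min ortho[OF j j] \<open>u j \<bullet> v = 0\<close>
        by (auto simp: inner_commute)
    qed
    then show ?thesis using eigenpair_combinationI[OF eig 1] by simp
  next
    case 2
    have "local_maximizer_on (sphere 0 1) (\<lambda>w. \<mu> * tensor_form m S w) v"
      using min 2 by (simp add: local_maximizer_on_def local_minimizer_on_def)
    then have zero: "u j \<bullet> v = 0" if "j \<in> {1..r}" "j \<noteq> i" for j
      using not_local_maximizer[OF eig \<open>\<mu> \<noteq> 0\<close> i(1) that(1)] i(2) that(2) by blast
    have "v = (\<Sum>j\<in>{i}. (u j \<bullet> v) *\<^sub>R u j)"
      by (subst exp, rule sum.mono_neutral_right) (use i zero in auto)
    then have v_eq: "v = (u i \<bullet> v) *\<^sub>R u i" by simp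
    have "v \<bullet> v = (u i \<bullet> v)\<^sup>2"
      by (subst v_eq) (simp add: power2_eq_square)
    then have "u i \<bullet> v = 1 \<or> u i \<bullet> v = -1" using v by (simp add: power2_eq_1_iff)
    moreover have "u i \<bullet> v \<noteq> 1" using \<mu>_eq 2 lam_pos[OF i(1)] by auto
    ultimately have neg: "u i \<bullet> v = -1" by blast
    have "odd (m - 2)"
      using \<mu>_eq 2 lam_pos[OF i(1)] by (cases "even (m - 2)") (auto simp: neg)
    then have "odd m" "\<mu> = - lam i" using \<mu>_eq m by (auto simp: neg)
    then show ?thesis using i(1) v_eq by (auto simp: neg)
  qed
qed

end

text \<open>The alternative for odd \<open>m\<close> in the last clause is genuine: the form is then
  an odd function, so each isolated maximum \<open>u i\<close> yields an isolated minimum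
  \<open>- u i\<close> with value \<open>- lam i\<close>.\<close>

theorem theorem4:
  fixes m r :: nat
    and S :: "('n::finite) tensor"
    and lam :: "nat \<Rightarrow> real"
    and u :: "nat \<Rightarrow> real ^ 'n"
  assumes "3 \<le> m" and "1 \<le> r" and "r \<le> CARD('n)"
    and "symmetric_tensor m S"
    and "\<And>is. length is = m \<Longrightarrow> S is = (\<Sum>i=1..r. lam i * tensor_power (u i) is)"
    and "\<And>i j. i \<in> {1..r} \<Longrightarrow> j \<in> {1..r} \<Longrightarrow> u i \<bullet> u j = (if i = j then 1 else 0)"
    and "\<And>i. i \<in> {1..r} \<Longrightarrow> 0 < lam i"
  shows
    "(\<forall>A \<mu> v. A \<subseteq> {1..r} \<and> A \<noteq> {} \<and> eigenpair_combination m lam u A \<mu> v \<longrightarrow>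
        Z_eigenpair m S \<mu> v) \<and>
     (\<forall>i\<in>{1..r}. isolated_local_max_solution m S (lam i) (u i)) \<and>
     (\<forall>A \<mu> v. A \<subseteq> {1..r} \<and> 1 < card A \<and> r < CARD('n) \<and>
        eigenpair_combination m lam u A \<mu> v \<longrightarrow> saddle_point_solution m S \<mu> v) \<and>
     (\<forall>A. A \<subseteq> {1..r} \<and> card A = CARD('n) \<longrightarrow>
        (\<forall>\<mu> v. eigenpair_combination m lam u A \<mu> v \<longrightarrow>
           isolated_local_min_solution m S \<mu> v) \<and>
        (\<forall>\<mu> v. isolated_local_min_solution m S \<mu> v \<longrightarrow>
           eigenpair_combination m lam u A \<mu> v \<or>
           odd m \<and> (\<exists>i\<in>{1..r}. \<mu> = - lam i \<and> v = - u i)))"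
proof -
  interpret orthonormal_tensor m r S lam u by unfold_locales (use assms in auto)
  \<comment> \<open>The chain \<open>card A \<le> r \<le> CARD('n)\<close> collapses to
    equalities.\<close>
  have full: "r = CARD('n) \<and> A = {1..r}" if "A \<subseteq> {1..r}" "card A = CARD('n)" for A
    using card_mono[OF _ that(1)] card_subset_eq[OF _ that(1)] that(2) assms(3) by auto
  have "isolated_local_min_solution m S \<mu> v"
    if "r = CARD('n)" "eigenpair_combination m lam u {1..r} \<mu> v" for \<mu> v
    using eigenpair_combinationD[OF subset_refl _ that(2)] assms(2)
    by (intro full_support_isolated_min[OF that(1)]) auto
  moreover have "eigenpair_combination m lam u {1..r} \<mu> v \<or>
      odd m \<and> (\<exists>i\<in>{1..r}. \<mu> = - lam i \<and> v = - u i)"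
    if "r = CARD('n)" "isolated_local_min_solution m S \<mu> v" for \<mu> v
    using that by (intro local_minimizer_classification)
      (auto simp: isolated_local_min_solution_def)
  ultimately have case3: "(\<forall>\<mu> v. eigenpair_combination m lam u A \<mu> v \<longrightarrow>
           isolated_local_min_solution m S \<mu> v) \<and>
        (\<forall>\<mu> v. isolated_local_min_solution m S \<mu> v \<longrightarrow>
           eigenpair_combination m lam u A \<mu> v \<or>
           odd m \<and> (\<exists>i\<in>{1..r}. \<mu> = - lam i \<and> v = - u i))"
    if "A \<subseteq> {1..r}" "card A = CARD('n)" for A
    using full[OF that] by simp
  show ?thesis
  proof (intro conjI)
    show "\<forall>A \<mu> v. A \<subseteq> {1..r} \<and> A \<noteq> {} \<and> eigenpair_combination m lam u A \<mu> v \<longrightarrow>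
        Z_eigenpair m S \<mu> v"
      using eigenpair_combination_eigenpair by blast
    show "\<forall>i\<in>{1..r}. isolated_local_max_solution m S (lam i) (u i)"
      using basis_isolated_max by blast
    show "\<forall>A \<mu> v. A \<subseteq> {1..r} \<and> 1 < card A \<and> r < CARD('n) \<and>
        eigenpair_combination m lam u A \<mu> v \<longrightarrow> saddle_point_solution m S \<mu> v"
      using eigenpair_combination_saddle by blast
  qed (intro allI impI, elim conjE, erule (1) case3)
qed

end
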